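(* Let $\varphi=(1+\sqrt5)/2$ and let $(s(n))_{n\ge 1}$ be Sada's sequence. For every $n\ge 1$: if $\{(n+1)\varphi\}<2-\varphi$, then $s(n)=n+1$; otherwise, $s(n)=\lfloor (n+1)/\varphi\rfloor$.
   Context: Here $\{x\}=x\bmod 1$ denotes the fractional part of $x$. The Hurt-Sada array $A=(A[n,k])_{n,k\ge 0}$ is defined as follows. Row $0$ is $A[0,k]=k$ for all $k\ge 0$. For $n\ge 1$, row $n$ is obtained from row $n-1$ by finding the unique occurrence of $n$ in row $n-1$, say $A[n-1,i]=n$, and shifting this entry $n$ positions to the right (it jumps over the next $n$ entries): $A[n,j]=A[n-1,j]$ for $0\le j<i$; $A[n,j]=A[n-1,j+1]$ for $i\le j<i+n$; $A[n,i+n]=n$; and $A[n,j]=A[n-1,j]$ for $j>i+n$. Each row is a permutation of $\{0,1,2,\ldots\}$. For $n\ge 1$, $p(n)$ is the unique $i$ with $A[n-1,i]=n$. Sada's sequence is $s(n)=A[n-1,p(n)+1]$ for $n\ge 1$, the first of the $n$ elements that $n$ jumps over. *)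

theory Defs
  imports Complex_Main
begin

definition golden_ratio :: real where
  "golden_ratio = (1 + sqrt 5) / 2"

definition position :: "(nat \<Rightarrow> nat) \<Rightarrow> nat \<Rightarrow> nat" where
  "position r m = (THE i. r i = m)"

definition jump :: "nat \<Rightarrow> (nat \<Rightarrow> nat) \<Rightarrow> nat \<Rightarrow> nat" where
  "jump n r = (\<lambda>j. let i = position r n in
     if j < i then r j
     else if j < i + n then r (j + 1)
     else if j = i + n then n
     else r j)"

primrec hurt_sada :: "nat \<Rightarrow> nat \<Rightarrow> nat" where
  "hurt_sada 0 = (\<lambda>k. k)"
| "hurt_sada (Suc n) = jump (Suc n) (hurt_sada n)"

(* Both sequences are meaningful only for n >= 1. *)

definition sada_pos :: "nat \<Rightarrow> nat" where
  "sada_pos n = position (hurt_sada (n - 1)) n"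

definition sada :: "nat \<Rightarrow> nat" where
  "sada n = hurt_sada (n - 1) (sada_pos n + 1)"

(* Every row is a permutation, so the description in position is always proper. *)

lemma position_eq:
  assumes "bij r"
  shows "r i = m \<longleftrightarrow> i = position r m"
proof -
  have ex1: "\<exists>!i. r i = m"
    using assms by (simp add: bij_iff)
  have "r (position r m) = m"
    unfolding position_def by (rule theI'[OF ex1])
  with ex1 show ?thesis
    by blast
qed

lemma bij_jump:
  assumes r: "bij r"
  shows "bij (jump n r)"
proof -
  define i where "i = position r n"
  define c where "c = (\<lambda>j. if j < i then j else if j < i + n then j + 1 else if j = i + n then i else j)"
  define d where "d = (\<lambda>j. if j < i then j else if j = i then i + n else if j \<le> i + n then j - 1 else j)"
  have "d (c j) = j" for j
    unfolding c_def d_def by presburger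
  moreover have "c (d j) = j" for j
    unfolding c_def d_def by presburger
  ultimately have "bij c"
    by (intro o_bij[where g = d]) (simp_all add: fun_eq_iff)
  moreover have "r i = n"
    using position_eq[OF r] i_def by blast
  then have "jump n r = r \<circ> c"
    unfolding jump_def Let_def i_def[symmetric] c_def by (simp add: fun_eq_iff)
  ultimately show ?thesis
    using r by (simp add: bij_comp)
qed

lemma bij_hurt_sada: "bij (hurt_sada n)"
proof (induction n)
  case 0
  show ?case
    using bij_id by (simp add: id_def)
next
  case (Suc n)
  then show ?case
    by (simp add: bij_jump)
qed

end

theory Submission
  imports Defs "HOL-Computational_Algebra.Polynomial"
begin

text \<open>
  Write \<open>g m = \<lfloor>m / \<phi>\<rfloor>\<close>. The entry \<open>v\<close> stays at \<open>v\<close> until the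
  jumps reach it, then moves one step to the left per row, until its own jump takes it from
  \<open>g (v + 1)\<close> to \<open>g (v + 1) + v\<close>; from there it again moves one step to the left per
  row until it comes to rest at \<open>v\<close>. This gives a closed formula for every position, which
  is proved by induction on the row from the single fact that \<open>k \<le> g m\<close> is equivalent to
  \<open>k + g k < m\<close> for \<open>k \<ge> 1\<close>. The entry next to \<open>n\<close> is then \<open>n + 1\<close> if
  \<open>g (n + 2) = g (n + 1)\<close>, and \<open>g (n + 1)\<close> otherwise.
\<close>

section \<open>Arithmetic of the golden ratio and its floors\<close>

definition golden_floor :: "nat \<Rightarrow> nat" where
  "golden_floor m = nat \<lfloor>real m / golden_ratio\<rfloor>"

lemma golden_ratio_bounds: "1 < golden_ratio" "golden_ratio < 2"
proof -
  have "sqrt 1 < sqrt 5" "sqrt 5 < sqrt 9"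
    by (simp_all only: real_sqrt_less_iff)
  moreover have "sqrt 9 = (3 :: real)"
    by (rule real_sqrt_unique) auto
  ultimately show "1 < golden_ratio" "golden_ratio < 2"
    by (auto simp: golden_ratio_def)
qed

lemma golden_ratio_square: "golden_ratio * golden_ratio = golden_ratio + 1"
  by (simp add: golden_ratio_def field_simps)

lemma divide_golden_ratio: "x / golden_ratio = x * golden_ratio - x"
  using golden_ratio_bounds golden_ratio_square
  by (simp add: divide_eq_eq left_diff_distrib mult.assoc) (simp add: algebra_simps)

text \<open>A rational root of the monic integer polynomial x^2 - x - 1 is an integer, and none lies
  strictly between 1 and 2.\<close>

lemma golden_ratio_irrational: "golden_ratio \<notin> \<rat>"
proof
  assume "golden_ratio \<in> \<rat>"
  moreover have "algebraic_int golden_ratio"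
  proof
    show "poly [:-1, -1, 1:] golden_ratio = 0"
      using golden_ratio_square by (simp add: algebra_simps)
  qed (auto simp: coeff_pCons split: nat.splits)
  ultimately have "golden_ratio \<in> \<int>"
    by (rule rational_algebraic_int_is_int[rotated])
  then obtain z where "golden_ratio = of_int z"
    by (rule Ints_cases)
  then have "1 < z" "z < 2"
    using golden_ratio_bounds by simp_all
  then show False
    by simp
qed

lemma golden_floor_bounds:
  "real (golden_floor m) \<le> real m / golden_ratio"
  "real m / golden_ratio < real (golden_floor m) + 1"
proof -
  have "real (golden_floor m) = of_int \<lfloor>real m / golden_ratio\<rfloor>"
    using golden_ratio_bounds by (simp add: golden_floor_def)
  then show "real (golden_floor m) \<le> real m / golden_ratio"
    "real m / golden_ratio < real (golden_floor m) + 1"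
    by linarith+
qed

lemma le_golden_floor_iff: "k \<le> golden_floor m \<longleftrightarrow> real k * golden_ratio \<le> real m"
proof -
  have "k \<le> golden_floor m \<longleftrightarrow> real k \<le> real m / golden_ratio"
    using golden_floor_bounds[of m] by linarith
  then show ?thesis
    using golden_ratio_bounds by (simp add: pos_le_divide_eq)
qed

lemma golden_floor_mono: "m \<le> n \<Longrightarrow> golden_floor m \<le> golden_floor n"
  using le_golden_floor_iff[of "golden_floor m" m] le_golden_floor_iff[of "golden_floor m" n]
  by linarith

text \<open>Since \<open>k + g k = \<lfloor>k \<phi>\<rfloor>\<close>, this says that \<open>k \<phi>\<close> is never the integer \<open>m\<close>.\<close>

lemma le_golden_floor_iff_add:
  assumes "k \<ge> 1"
  shows "k \<le> golden_floor m \<longleftrightarrow> k + golden_floor k < m"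
proof -
  have "real k * golden_ratio \<noteq> real m"
  proof
    assume "real k * golden_ratio = real m"
    with assms have "golden_ratio = real m / real k"
      by (simp add: field_simps)
    also have "\<dots> \<in> \<rat>"
      by simp
    finally have "golden_ratio \<in> \<rat>" .
    then show False
      using golden_ratio_irrational by contradiction
  qed
  then show ?thesis
    using golden_floor_bounds[of k] unfolding le_golden_floor_iff divide_golden_ratio by linarith
qed

lemma golden_floor_Suc_le: "golden_floor (Suc m) \<le> Suc (golden_floor m)"
proof -
  have "real (Suc m) / golden_ratio \<le> real m / golden_ratio + 1"
    using golden_ratio_bounds by (simp add: divide_golden_ratio distrib_right)
  then show ?thesis
    using golden_floor_bounds[of m] golden_floor_bounds[of "Suc m"] by linarith
qed

lemma golden_floor_less: "m \<ge> 1 \<Longrightarrow> golden_floor m < m"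
  using le_golden_floor_iff_add[of m m] by linarith

lemma golden_floor_small: "golden_floor (Suc 0) = 0" "golden_floor 2 = 1" "golden_floor 3 = 1"
proof -
  show 1: "golden_floor (Suc 0) = 0"
    using golden_floor_less[of 1] by simp
  show 2: "golden_floor 2 = 1"
    using golden_floor_less[of 2] le_golden_floor_iff_add[of 1 2] 1 by simp
  show "golden_floor 3 = 1"
    using le_golden_floor_iff_add[of 1 3] le_golden_floor_iff_add[of 2 3] 1 2 by simp
qed

lemma golden_floor_add_2_le:
  assumes "m \<ge> 3"
  shows "golden_floor m + 2 \<le> m"
proof -
  have "golden_floor 2 \<le> golden_floor (m - 1)"
    using assms by (intro golden_floor_mono) simp
  then show ?thesis
    using assms le_golden_floor_iff_add[of "m - 1" m] golden_floor_small(2) by linarith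
qed

text \<open>As 1 / \<phi> = \<phi> - 1, the numbers m \<phi> and m / \<phi> have the same fractional
  part. Adding \<phi> - 1 crosses no integer exactly when that part is below 1 - (\<phi> -
  1).\<close>

lemma golden_floor_Suc_eq_iff:
  "golden_floor (Suc m) = golden_floor m \<longleftrightarrow> frac (real m * golden_ratio) < 2 - golden_ratio"
proof -
  have "\<lfloor>real m * golden_ratio\<rfloor> = int (golden_floor m + m)"
    using golden_floor_bounds[of m] by (simp add: floor_eq_iff divide_golden_ratio)
  then have frac: "frac (real m * golden_ratio) = real m / golden_ratio - real (golden_floor m)"
    by (simp add: frac_def divide_golden_ratio)
  have step: "real (Suc m) / golden_ratio = real m / golden_ratio + golden_ratio - 1"
    by (simp add: divide_golden_ratio distrib_right)
  show ?thesis
    using golden_floor_bounds[of m] golden_floor_bounds[of "Suc m"] golden_ratio_bounds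
    unfolding frac step by linarith
qed

section \<open>Positions of the entries in every row\<close>

lemma jump_self:
  assumes "bij r"
  shows "jump n r (position r n + n) = n"
  using position_eq[OF assms, of "position r n" n] by (cases n) (simp_all add: jump_def)

lemma jump_other:
  assumes "bij r" "r i \<noteq> n"
  shows "jump n r (if position r n < i \<and> i \<le> position r n + n then i - 1 else i) = r i"
proof -
  have "i \<noteq> position r n"
    using position_eq[OF assms(1)] assms(2) by blast
  then show ?thesis
    by (auto simp: jump_def Let_def)
qed

text \<open>The \<open>max\<close> is the rest at \<open>v\<close>; it also absorbs a difference
  truncated to 0. The waiting at \<open>v\<close> ends with row \<open>golden_floor (v + 1)\<close>,
  where the first step to the left occurs.\<close>

definition row_position :: "nat \<Rightarrow> nat \<Rightarrow> nat" where
  "row_position n v =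
     (if v \<le> n then max v (golden_floor (v + 1) + 2 * v - n)
      else if n + 1 \<le> golden_floor (v + 1) then v
      else v + golden_floor (v + 1) - (n + 1))"

lemma row_position_next: "row_position n (Suc n) = golden_floor (n + 2)"
  using golden_floor_less[of "n + 2"] by (auto simp: row_position_def)

lemma row_position_Suc_self: "row_position (Suc n) (Suc n) = golden_floor (n + 2) + Suc n"
  by (simp add: row_position_def max_def)

lemma row_position_Suc_other:
  assumes "v \<noteq> Suc n"
  shows "row_position (Suc n) v =
    (if golden_floor (n + 2) < row_position n v \<and>
        row_position n v \<le> golden_floor (n + 2) + Suc n
     then row_position n v - 1 else row_position n v)"
proof (cases "v \<le> n")
  case True
  define G where "G = golden_floor (v + 1)"
  have "G \<le> golden_floor (n + 2)"
    unfolding G_def using True by (intro golden_floor_mono) simp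
  with True have upper: "row_position n v \<le> golden_floor (n + 2) + Suc n"
    unfolding row_position_def by (simp add: G_def)
  show ?thesis
  proof (cases "n < G + v")
    case True
    \<comment> \<open>\<open>v\<close> is still to the right of its resting place, so the jump
      starting at or before \<open>v\<close> passes over it.\<close>
    have "golden_floor (n + 2) \<le> golden_floor (G + v + 1)"
      using True by (intro golden_floor_mono) simp
    also have "\<dots> \<le> v"
      using le_golden_floor_iff_add[of "v + 1" "G + v + 1"] by (simp add: G_def)
    finally have "golden_floor (n + 2) \<le> v" .
    with True \<open>v \<le> n\<close> upper show ?thesis
      by (auto simp: row_position_def G_def)
  next
    case False
    \<comment> \<open>\<open>v\<close> is at rest, and every further jump starts to its
      right.\<close>
    have "v + 1 \<le> golden_floor (G + v + 2)"
      using le_golden_floor_iff_add[of "v + 1" "G + v + 2"] by (simp add: G_def)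
    also have "\<dots> \<le> golden_floor (n + 2)"
      using False by (intro golden_floor_mono) simp
    finally show ?thesis
      using False \<open>v \<le> n\<close> by (auto simp: row_position_def G_def)
  qed
next
  case False
  with assms have v: "v \<ge> n + 2"
    by simp
  have less: "golden_floor (n + 2) < n + 2"
    by (rule golden_floor_less) simp
  have le: "golden_floor (n + 2) \<le> golden_floor (v + 1)"
    using v by (intro golden_floor_mono) simp
  \<comment> \<open>\<open>n + 2 \<le> golden_floor (v + 1)\<close>, the condition for waiting in
    the next row too, says exactly that \<open>v\<close> lies beyond the landing place
    \<open>golden_floor (n + 2) + Suc n\<close>.\<close>
  show ?thesis
    using le_golden_floor_iff_add[of "n + 2" "v + 1"] v less le
    by (auto simp: row_position_def)
qed

lemma hurt_sada_row_position: "hurt_sada n (row_position n v) = v"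
proof (induction n arbitrary: v)
  case 0
  show ?case
    using golden_floor_mono[of 2 "v + 1"]
    by (cases v) (auto simp: row_position_def golden_floor_small)
next
  case (Suc n)
  have pos: "position (hurt_sada n) (Suc n) = golden_floor (n + 2)"
    using position_eq[OF bij_hurt_sada] Suc.IH[of "Suc n"] row_position_next[of n] by metis
  show ?case
  proof (cases "v = Suc n")
    case True
    then show ?thesis
      using jump_self[OF bij_hurt_sada, of "Suc n" n] by (simp add: pos row_position_Suc_self)
  next
    case False
    then show ?thesis
      using jump_other[OF bij_hurt_sada, of n "row_position n v" "Suc n"] Suc.IH[of v]
      by (simp add: pos row_position_Suc_other)
  qed
qed

section \<open>Evaluation of Sada's sequence\<close>

lemma sada_eqI:
  assumes "n \<ge> 1" "row_position (n - 1) v = golden_floor (n + 1) + 1"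
  shows "sada n = v"
proof -
  have "hurt_sada (n - 1) (golden_floor (n + 1)) = n"
    using hurt_sada_row_position[of "n - 1" n] row_position_next[of "n - 1"] assms(1) by simp
  then have "sada_pos n = golden_floor (n + 1)"
    using position_eq[OF bij_hurt_sada] by (metis sada_pos_def)
  then show ?thesis
    using hurt_sada_row_position[of "n - 1" v] assms(2) by (simp add: sada_def)
qed

lemma sada_eq:
  assumes n: "n \<ge> 1"
  shows "sada n = (if golden_floor (n + 2) = golden_floor (n + 1)
                   then n + 1 else golden_floor (n + 1))"
proof (cases "golden_floor (n + 2) = golden_floor (n + 1)")
  case True
  \<comment> \<open>The bound \<open>golden_floor (n + 2) \<le> n\<close> leaves the waiting branch
    only with equality, where both branches agree.\<close>
  have "row_position (n - 1) (n + 1) = golden_floor (n + 2) + 1"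
    using n golden_floor_add_2_le[of "n + 2"] unfolding row_position_def by auto
  with True n show ?thesis
    by (simp add: sada_eqI)
next
  case False
  define G where "G = golden_floor (n + 1)"
  have "golden_floor (n + 2) = G + 1"
    using False golden_floor_Suc_le[of "n + 1"] golden_floor_mono[of "n + 1" "n + 2"]
    by (simp add: G_def)
  \<comment> \<open>The floor reaches \<open>G + 1\<close> at \<open>n + 2\<close> but not at
    \<open>n + 1\<close>, which pins down \<open>golden_floor (G + 1)\<close>: entry
    \<open>G\<close> is then one step short of its rest.\<close>
  then have G: "G + golden_floor (G + 1) = n"
    using le_golden_floor_iff_add[of "G + 1" "n + 1"] le_golden_floor_iff_add[of "G + 1" "n + 2"]
    by (simp add: G_def)
  have "n \<noteq> 1"
    using False golden_floor_small(2,3) by (auto simp: eval_nat_numeral)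
  then have "G + 1 \<le> n"
    using n golden_floor_add_2_le[of "n + 1"] by (simp add: G_def)
  with G have "row_position (n - 1) G = G + 1"
    by (auto simp: row_position_def)
  then show ?thesis
    using False n by (simp add: sada_eqI G_def)
qed

theorem theorem5:
  fixes n :: nat
  assumes "n \<ge> 1"
  shows "(frac (real (n + 1) * golden_ratio) < 2 - golden_ratio \<longrightarrow> sada n = n + 1) \<and>
         (\<not> frac (real (n + 1) * golden_ratio) < 2 - golden_ratio \<longrightarrow>
            int (sada n) = \<lfloor>real (n + 1) / golden_ratio\<rfloor>)"
proof -
  have "int (golden_floor (n + 1)) = \<lfloor>real (n + 1) / golden_ratio\<rfloor>"
    using golden_ratio_bounds by (simp add: golden_floor_def)
  then show ?thesis
    using sada_eq[OF assms] golden_floor_Suc_eq_iff[of "n + 1"] by (simp del: of_nat_add)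
qed

end
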